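(* Let $n\ge 0$ be an integer, let $a\in\mathbb{C}$ with $a\neq 0$, and put $q=\frac{a}{4}+\frac14$ (so $2q=\frac{a+1}{2}$). Then $$\sum_{j=0}^{2n}\frac{(-a/2)^{-j}\,\mathcal{E}(j+1,2q)}{\Gamma(j+1)\,\Gamma(2n-j+1)}=\frac{\mathcal{E}(2n)}{2\,\Gamma(2n+1)\,a^{2n-1}} .$$
   Context: $\mathcal{E}(n,x)$ denotes the $n$-th Euler polynomial, defined by $\frac{2e^{xt}}{e^{t}+1}=\sum_{n\ge 0}\mathcal{E}(n,x)\frac{t^n}{n!}$, and $\mathcal{E}(n)=2^{n}\mathcal{E}(n,1/2)$ denotes the $n$-th Euler number (so $\frac{1}{\cosh t}=\sum_{n\ge0}\mathcal{E}(n)\frac{t^n}{n!}$). *)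

theory Defs
  imports "HOL-Analysis.Analysis" "HOL-Computational_Algebra.Computational_Algebra"
begin

(* fps_exp c is the formal series of exp (c t); the denominator has constant coefficient 2,
   so the quotient is an honest one. The factor fact n is due to the series being exponential. *)
definition euler_gf :: "complex \<Rightarrow> complex fps" where
  "euler_gf x = (2 * fps_exp x) / (fps_exp 1 + 1)"

definition euler_poly :: "nat \<Rightarrow> complex \<Rightarrow> complex" where
  "euler_poly n x = fact n * fps_nth (euler_gf x) n"

definition euler_number :: "nat \<Rightarrow> complex" where
  "euler_number n = 2 ^ n * euler_poly n (1 / 2)"

lemma euler_gf_mult: "euler_gf x * (fps_exp 1 + 1) = 2 * fps_exp x"
proof -
  have "fps_nth (fps_exp 1 + 1 :: complex fps) 0 \<noteq> 0"
    by simp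
  then have "is_unit (fps_exp 1 + 1 :: complex fps)"
    by (simp only: fps_is_unit_iff not_False_eq_True)
  then show ?thesis
    unfolding euler_gf_def by (simp add: unit_imp_dvd)
qed

lemma euler_poly_gf:
  "Abs_fps (\<lambda>n. euler_poly n x / fact n) * (fps_exp 1 + 1) = 2 * fps_exp x"
proof -
  have "Abs_fps (\<lambda>n. euler_poly n x / fact n) = euler_gf x"
    by (simp add: fps_eq_iff euler_poly_def)
  then show ?thesis
    by (simp add: euler_gf_mult)
qed

end

theory Submission
  imports Defs
begin

text \<open>
  Read umbrally, the identity is the binomial theorem. Put \<open>b = a / 2\<close>, \<open>N = 2 * n\<close>, and let \<open>L\<close> be
  the linear functional on polynomials in an indeterminate \<open>\<epsilon>\<close> that sends \<open>\<epsilon>\<^sup>k\<close> to the \<open>k\<close>-th Euler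
  polynomial at \<open>1 / 2\<close>. Since translating the argument multiplies the generating function by an
  exponential, \<open>L\<close> sends \<open>(b + \<epsilon>)\<^sup>m\<close> to the \<open>m\<close>-th Euler polynomial at \<open>1 / 2 + b\<close>, which is the
  point \<open>2 * q\<close> (\<open>umbral_linear_power\<close>). After multiplication by \<open>N!\<close> and \<open>b\<^sup>N\<close> the left-hand
  side is therefore the value of \<open>L\<close> at
  \<open>\<Sum>j\<le>N. (N choose j) * (-1)\<^sup>j * b\<^bsup>N - j\<^esup> * (b + \<epsilon>)\<^bsup>j + 1\<^esup>\<close>, which the binomial theorem
  collapses to \<open>(b + \<epsilon>) * (b - (b + \<epsilon>))\<^sup>N = b * \<epsilon>\<^sup>N + \<epsilon>\<^bsup>N + 1\<^esup>\<close>, \<open>N\<close> being even.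
  As \<open>N + 1\<close> is odd, the reflection formula (\<open>euler_poly_reflect\<close>) makes \<open>L\<close> vanish on
  \<open>\<epsilon>\<^bsup>N + 1\<^esup>\<close>, and only \<open>b\<close> times the \<open>N\<close>-th Euler polynomial at \<open>1 / 2\<close> is left.
\<close>

lemma euler_gf_eqI:
  assumes "F * (fps_exp 1 + 1) = 2 * fps_exp x"
  shows "F = euler_gf x"
proof -
  have "fps_nth (fps_exp 1 + 1 :: complex fps) 0 \<noteq> 0"
    by simp
  then have "(fps_exp 1 + 1 :: complex fps) \<noteq> 0"
    by (metis fps_zero_nth)
  then show ?thesis
    using assms euler_gf_mult[of x] by (metis mult_right_cancel)
qed

lemma euler_gf_add: "euler_gf (x + y) = euler_gf x * fps_exp y"
proof -
  have "euler_gf x * fps_exp y * (fps_exp 1 + 1) = (euler_gf x * (fps_exp 1 + 1)) * fps_exp y"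
    by (simp only: mult_ac)
  also have "\<dots> = 2 * fps_exp (x + y)"
    by (simp add: euler_gf_mult fps_exp_add_mult mult_ac)
  finally show ?thesis
    by (rule euler_gf_eqI[symmetric])
qed

lemma euler_poly_add:
  "euler_poly m (x + y) = (\<Sum>k\<le>m. of_nat (m choose k) * y ^ (m - k) * euler_poly k x)"
proof -
  have "euler_poly m (x + y) =
      (\<Sum>k\<le>m. fact m * (fps_nth (euler_gf x) k * (y ^ (m - k) / fact (m - k))))"
    by (simp add: euler_poly_def euler_gf_add fps_mult_nth sum_distrib_left atMost_atLeast0)
  also have "\<dots> = (\<Sum>k\<le>m. of_nat (m choose k) * y ^ (m - k) * euler_poly k x)"
    by (intro sum.cong refl) (simp add: euler_poly_def binomial_fact field_simps)
  finally show ?thesis .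
qed

text \<open>
  The function \<open>2 exp (x t) / (exp t + 1)\<close> becomes \<open>2 exp ((1 - x) t) / (exp t + 1)\<close> when \<open>t\<close> is
  replaced by \<open>- t\<close>, as one sees on multiplying numerator and denominator by \<open>exp t\<close>.
\<close>

lemma euler_poly_reflect: "euler_poly m (1 - x) = (-1) ^ m * euler_poly m x"
proof -
  let ?r = "fps_const (-1) * fps_X :: complex fps"
  have "(euler_gf x oo ?r) * (fps_exp (-1) + 1) = (euler_gf x * (fps_exp 1 + 1)) oo ?r"
    by (simp add: fps_compose_mult_distrib fps_compose_add_distrib)
  also have "\<dots> = 2 * fps_exp (-x)"
    by (simp add: euler_gf_mult fps_compose_mult_distrib)
  finally have *: "(euler_gf x oo ?r) * (fps_exp (-1) + 1) = 2 * fps_exp (-x)" .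
  have "fps_exp 1 + 1 = (fps_exp (-1) + 1) * (fps_exp 1 :: complex fps)"
    by (simp add: distrib_right fps_exp_add_mult[symmetric])
  then have "(euler_gf x oo ?r) * (fps_exp 1 + 1)
      = ((euler_gf x oo ?r) * (fps_exp (-1) + 1)) * fps_exp 1"
    by (simp only: mult_ac)
  also have "\<dots> = 2 * fps_exp (1 - x)"
    using fps_exp_add_mult[of "-x" 1] by (simp add: * mult.assoc)
  finally have "euler_gf (1 - x) = euler_gf x oo ?r"
    by (rule euler_gf_eqI[symmetric])
  then show ?thesis
    by (simp add: euler_poly_def fps_compose_linear del: fps_const_neg)
qed

lemma euler_poly_half_odd: "odd m \<Longrightarrow> euler_poly m (1 / 2) = 0"
  using euler_poly_reflect[of m "1 / 2"] by simp

text \<open>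
  The summation bound \<open>d\<close> does not depend on \<open>p\<close>, so that linearity is immediate; the intended
  value arises for polynomials of degree at most \<open>d\<close>.
\<close>

definition umbral :: "nat \<Rightarrow> complex \<Rightarrow> complex poly \<Rightarrow> complex" where
  "umbral d x p = (\<Sum>k\<le>d. coeff p k * euler_poly k x)"

lemma umbral_add: "umbral d x (p + r) = umbral d x p + umbral d x r"
  by (simp add: umbral_def sum.distrib distrib_right)

lemma umbral_smult: "umbral d x (smult c p) = c * umbral d x p"
  by (simp add: umbral_def sum_distrib_left mult_ac)

lemma umbral_sum: "umbral d x (\<Sum>i\<in>A. f i) = (\<Sum>i\<in>A. umbral d x (f i))"
  unfolding umbral_def coeff_sum sum_distrib_right by (rule sum.swap)

lemma umbral_monom: "m \<le> d \<Longrightarrow> umbral d x (monom c m) = c * euler_poly m x"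
  by (simp add: umbral_def if_distrib[of "\<lambda>z. z * _"] sum.delta' cong: if_cong)

lemma umbral_linear_power:
  assumes "m \<le> d"
  shows "umbral d x ([:y, 1:] ^ m) = euler_poly m (x + y)"
proof -
  have "umbral d x ([:y, 1:] ^ m) = (\<Sum>k\<le>m. coeff ([:y, 1:] ^ m) k * euler_poly k x)"
    unfolding umbral_def using assms
    by (intro sum.mono_neutral_right) (auto intro!: coeff_eq_0 simp: degree_linear_power)
  also have "\<dots> = euler_poly m (x + y)"
    unfolding euler_poly_add by (intro sum.cong refl) (simp add: coeff_linear_poly_power)
  finally show ?thesis .
qed

text \<open>
  One factor \<open>y + \<epsilon>\<close> comes out of the sum; what remains is the binomial expansion of
  \<open>(y - (y + \<epsilon>))\<^sup>N\<close>, in which \<open>y\<close> cancels.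
\<close>

lemma alternating_sum_linear_powers:
  fixes y :: "'a :: comm_ring_1"
  shows "(\<Sum>j\<le>N. smult (of_nat (N choose j) * (-1) ^ j * y ^ (N - j)) ([:y, 1:] ^ (j + 1)))
    = smult ((-1) ^ N) (monom y N + monom 1 (N + 1))"
proof -
  define u where "u = [:y, 1:]"
  have minus_u_power: "(- u) ^ j = smult ((-1) ^ j) (u ^ j)" for j
    by (simp flip: smult_power)
  have "(\<Sum>j\<le>N. smult (of_nat (N choose j) * (-1) ^ j * y ^ (N - j)) (u ^ (j + 1)))
      = (\<Sum>j\<le>N. of_nat (N choose j) * (- u) ^ j * [:y:] ^ (N - j)) * u"
    unfolding sum_distrib_right
    by (intro sum.cong refl)
       (simp add: minus_u_power poly_const_pow of_nat_poly power_add mult_ac)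
  also have "\<dots> = (- u + [:y:]) ^ N * u"
    by (simp only: binomial_ring)
  also have "- u + [:y:] = monom (-1) 1"
    by (simp add: u_def monom_altdef)
  also have "monom (-1) 1 ^ N = smult ((-1) ^ N) (monom (1 :: 'a) N)"
    by (simp add: monom_power smult_monom)
  also have "\<dots> * u = smult ((-1) ^ N) (monom y N + monom 1 (N + 1))"
    by (simp add: poly_eq_iff coeff_monom_mult coeff_pCons u_def split: nat.splits)
  finally show ?thesis
    by (simp only: u_def)
qed

lemma alternating_sum_euler_poly:
  assumes "even N"
  shows "(\<Sum>j\<le>N. of_nat (N choose j) * (-1) ^ j * b ^ (N - j) * euler_poly (j + 1) (1 / 2 + b))
    = b * euler_poly N (1 / 2)"
proof -
  have "(\<Sum>j\<le>N. of_nat (N choose j) * (-1) ^ j * b ^ (N - j) * euler_poly (j + 1) (1 / 2 + b))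
      = umbral (N + 1) (1 / 2)
          (\<Sum>j\<le>N. smult (of_nat (N choose j) * (-1) ^ j * b ^ (N - j)) ([:b, 1:] ^ (j + 1)))"
    unfolding umbral_sum umbral_smult
    by (intro sum.cong refl) (simp add: umbral_linear_power del: power_Suc)
  also have "\<dots> = b * euler_poly N (1 / 2)"
    unfolding alternating_sum_linear_powers
    using assms by (simp add: umbral_smult umbral_add umbral_monom euler_poly_half_odd)
  finally show ?thesis .
qed

theorem mainTheorem3:
  fixes n :: nat and a q :: complex
  assumes "a \<noteq> 0"
    and "q = a / 4 + 1 / 4"
  shows "(\<Sum>j=0..2 * n. ((- a / 2) powi (- int j) * euler_poly (j + 1) (2 * q)) /
             (Gamma (of_nat j + 1) * Gamma (2 * of_nat n - of_nat j + 1)))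
       = euler_number (2 * n) / (2 * Gamma (2 * of_nat n + 1) * a powi (2 * int n - 1))"
proof -
  define b where "b = a / 2"
  define N where "N = 2 * n"
  have a: "a = 2 * b" and b: "b \<noteq> 0"
    using assms(1) by (simp_all add: b_def)
  have q: "2 * q = 1 / 2 + b"
    by (simp add: assms(2) b_def)
  have Gamma_Suc: "Gamma (of_nat k + 1) = (fact k :: complex)" for k
    by (metis Gamma_fact add.commute)
  have "(\<Sum>j=0..N. ((- a / 2) powi (- int j) * euler_poly (j + 1) (2 * q)) /
          (Gamma (of_nat j + 1) * Gamma (2 * of_nat n - of_nat j + 1)))
      = (\<Sum>j\<le>N. of_nat (N choose j) * (-1) ^ j * b ^ (N - j) * euler_poly (j + 1) (1 / 2 + b))
          / (fact N * b ^ N)"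
    unfolding sum_divide_distrib
  proof (intro sum.cong)
    fix j assume "j \<in> {..N}"
    then have j: "j \<le> N" by simp
    have "2 * of_nat n - of_nat j + 1 = (of_nat (N - j) + 1 :: complex)"
      using j by (simp add: N_def of_nat_diff)
    then have 1: "Gamma (2 * of_nat n - of_nat j + 1) = (fact (N - j) :: complex)"
      by (simp only: Gamma_Suc)
    have "- a / 2 = (-1) * b"
      by (simp add: a)
    then have "(- a / 2) powi (- int j) = inverse ((-1) ^ j * b ^ j)"
      by (simp only: power_int_minus power_int_of_nat power_mult_distrib)
    also have "\<dots> = (-1) ^ j / b ^ j"
      by (simp add: minus_one_power_iff divide_inverse)
    finally have 2: "(- a / 2) powi (- int j) = (-1) ^ j / b ^ j" .
    have 3: "b ^ N = b ^ j * b ^ (N - j)"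
      using j by (simp add: power_add[symmetric])
    show "((- a / 2) powi (- int j) * euler_poly (j + 1) (2 * q)) /
          (Gamma (of_nat j + 1) * Gamma (2 * of_nat n - of_nat j + 1))
        = of_nat (N choose j) * (-1) ^ j * b ^ (N - j) * euler_poly (j + 1) (1 / 2 + b)
          / (fact N * b ^ N)"
      unfolding 1 2 3 q Gamma_Suc binomial_fact[OF j] using b by (simp add: field_simps)
  qed auto
  also have "\<dots> = b * euler_poly N (1 / 2) / (fact N * b ^ N)"
    by (subst alternating_sum_euler_poly) (simp_all add: N_def)
  also have "\<dots> = euler_number N / (2 * Gamma (2 * of_nat n + 1) * a powi (2 * int n - 1))"
  proof -
    have "a powi (2 * int n - 1) = a powi (int N) / a"
      using assms(1) by (simp add: power_int_diff N_def)
    then have 1: "a powi (2 * int n - 1) = 2 ^ N * b ^ N / (2 * b)"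
      by (simp add: a power_mult_distrib)
    have 2: "Gamma (2 * of_nat n + 1) = (fact N :: complex)"
      using Gamma_Suc[of N] by (simp add: N_def)
    show ?thesis
      unfolding 1 2 euler_number_def using b by (simp add: field_simps)
  qed
  finally show ?thesis
    by (simp only: N_def)
qed

end
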